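(* Let $A,B,H,K$ be any logically independent events. A probability assessment $\mathcal{P}=(x,y,z)$ on the family of conditional events $\mathcal{F}=\{A|H,\ (B|K)|_{F}(A|H),\ (A|H)\wedge_{K}(B|K)\}$ is coherent if and only if $(x,y)\in[0,1]^2$ and $z\in[z',z'']$, where $z'=0$ and $z''=T^{H}_0(x,y)$, where $$T^{H}_0(x,y)=\begin{cases}0, & \text{if } x=0 \text{ or } y=0,\\ \dfrac{xy}{x+y-xy}, & \text{if } x\neq 0 \text{ and } y\neq 0,\end{cases}$$ is the Hamacher t-norm with parameter $\lambda=0$.
   Context: Events are two-valued entities (true/false), identified with their indicators (values $1/0$). $\emptyset$ is the impossible event; $AB$ denotes $A\wedge B$; $\overline{A}$ is the negation of $A$. Four events are logically independent if all $16$ conjunctions obtained by taking each event or its negation are different from $\emptyset$. For events $E,H$ with $H\neq\emptyset$, the conditional event $E|H$ is true if $EH$ is true, false if $\overline{E}H$ is true, void if $\overline{H}$ is true. Coherence: a real vector $\mathcal{P}=(p_1,\dots,p_n)$, with $p_j=P(E_j|H_j)$, on $\mathcal{F}=\{E_1|H_1,\dots,E_n|H_n\}$ is coherent iff for every nonempty $J\subseteq\{1,\dots,n\}$ and all real numbers $s_j$ ($j\in J$), the random gain $G=\sum_{j\in J}s_jH_j(E_j-p_j)$, restricted to the cases where $\bigvee_{j\in J}H_j$ is true, satisfies $\min G\le 0\le\max G$. Farrell iterated conditional: $(B|K)|_{F}(A|H)=AHBK|(AHBK\vee AH\overline{B}K\vee\overline{H}\,\overline{B}K)$ (a conditional event).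 Kleene–Lukasiewicz–Heyting–de Finetti conjunction: $(A|H)\wedge_{K}(B|K)=AHBK|(HK\vee\overline{A}H\vee\overline{B}K)$ (a conditional event; the subscript $K$ in $\wedge_K$ and the superscript $H$ in $T_0^H$ are only names, unrelated to the events $K,H$). *)

theory Defs
  imports Complex_Main "HOL-Library.Indicator_Function"
begin

text \<open>
  Events are subsets of a set \<open>UNIV :: 'w set\<close> of elementary cases: the impossible event is
  \<open>{}\<close>, conjunction is \<open>\<inter>\<close>, disjunction is \<open>\<union>\<close>, and negation is complement.
\<close>

definition logically_independent ::
    "'w set \<Rightarrow> 'w set \<Rightarrow> 'w set \<Rightarrow> 'w set \<Rightarrow> bool" where
  "logically_independent A B H K \<longleftrightarrow>
     (\<forall>A'\<in>{A, - A}. \<forall>B'\<in>{B, - B}. \<forall>H'\<in>{H, - H}. \<forall>K'\<in>{K, - K}.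
        A' \<inter> B' \<inter> H' \<inter> K' \<noteq> {})"

text \<open>
  \<open>E \<parallel> H\<close> is the conditional event ``E given H''.  The type does not enforce \<open>H \<noteq> {}\<close>;
  this requirement is part of \<open>coherent\<close> below.
\<close>

datatype 'w cond_event = Cond (conclusion: "'w set") (condition: "'w set") (infix \<open>\<parallel>\<close> 55)

text \<open>\<open>farrell (B \<parallel> K) (A \<parallel> H)\<close> is \<open>B|K\<close> given \<open>A|H\<close>: the second argument is the one
  conditioned on.\<close>

fun farrell :: "'w cond_event \<Rightarrow> 'w cond_event \<Rightarrow> 'w cond_event" where
  "farrell (B \<parallel> K) (A \<parallel> H) =
     (A \<inter> H \<inter> B \<inter> K) \<parallel>
       ((A \<inter> H \<inter> B \<inter> K) \<union> (A \<inter> H \<inter> - B \<inter> K) \<union> (- H \<inter> - B \<inter> K))"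

fun conj_K :: "'w cond_event \<Rightarrow> 'w cond_event \<Rightarrow> 'w cond_event" where
  "conj_K (A \<parallel> H) (B \<parallel> K) =
     (A \<inter> H \<inter> B \<inter> K) \<parallel> ((H \<inter> K) \<union> (- A \<inter> H) \<union> (- B \<inter> K))"

definition gain ::
    "'w cond_event list \<Rightarrow> real list \<Rightarrow> nat set \<Rightarrow> (nat \<Rightarrow> real) \<Rightarrow> 'w \<Rightarrow> real" where
  "gain F P J s w =
     (\<Sum>j\<in>J. s j * indicator (condition (F ! j)) w * (indicator (conclusion (F ! j)) w - P ! j))"

text \<open>A gain takes finitely many values even if \<open>'w\<close> is infinite, so \<open>Min\<close> and \<open>Max\<close> in
  \<open>coherent\<close> are applied to finite nonempty sets.\<close>

lemma finite_range_gain: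
  assumes "finite J"
  shows "finite (range (gain F P J s))"
  using assms
proof (induction J)
  case empty
  then show ?case by (simp add: gain_def)
next
  case (insert j J)
  let ?t = "\<lambda>w. s j * indicator (condition (F ! j)) w * (indicator (conclusion (F ! j)) w - P ! j)"
  have "range ?t \<subseteq> {0, s j * (1 - P ! j), s j * (0 - P ! j)}"
    by (auto simp: indicator_def)
  then have "finite (range ?t)"
    by (rule finite_subset) simp
  then have "finite ((\<lambda>(u, v). u + v) ` (range ?t \<times> range (gain F P J s)))"
    using insert.IH by simp
  moreover have "range (gain F P (insert j J) s) \<subseteq>
      (\<lambda>(u, v). u + v) ` (range ?t \<times> range (gain F P J s))"
    using insert.hyps by (auto simp: gain_def)
  ultimately show ?case
    by (rule rev_finite_subset)
qed

definition coherent :: "'w cond_event list \<Rightarrow> real list \<Rightarrow> bool" where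
  "coherent F P \<longleftrightarrow>
     length P = length F \<and>
     (\<forall>C\<in>set F. condition C \<noteq> {}) \<and>
     (\<forall>J s. J \<noteq> {} \<and> J \<subseteq> {..<length F} \<longrightarrow>
        Min (gain F P J s ` (\<Union>j\<in>J. condition (F ! j))) \<le> 0 \<and>
        0 \<le> Max (gain F P J s ` (\<Union>j\<in>J. condition (F ! j))))"

definition hamacher0 :: "real \<Rightarrow> real \<Rightarrow> real" where
  "hamacher0 x y = (if x = 0 \<or> y = 0 then 0 else x * y / (x + y - x * y))"

end

theory Submission imports Defs begin

text \<open>
  Coherence is a statement about two dual linear systems.  A bet that loses in every relevant case
  refutes it; conversely, if some nonnegative, nonzero weights on relevant cases make each single
  bet fair, the weighted mean of every gain is \<open>0\<close>, so no bet can lose surely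
  (\<open>ex_nonneg_gain_if_fair_weights\<close>).

  For the three conditional events of the theorem there are only five cases to distinguish in which
  some of them is not void; below, \<open>1\<close>, \<open>0\<close> and \<open>v\<close> stand for true, false and void, in the order
  \<open>A|H\<close>, Farrell conditional, conjunction:
  \<open>A H B K\<close> gives \<open>111\<close>; \<open>A H \<not>B K\<close> gives \<open>100\<close>; \<open>A H \<not>K\<close> gives \<open>1vv\<close>; \<open>\<not>A H\<close> gives \<open>0v0\<close>;
  \<open>\<not>H \<not>B K\<close> gives \<open>v00\<close>.

  Let \<open>0 < x < 1\<close> and \<open>y\<close>, \<open>z\<close> be positive.  To reach a large \<open>z\<close> one should not waste weight on
  \<open>100\<close>.  With the
  conjunction's condition normalised to weight \<open>1\<close>, fairness then forces the weights \<open>z\<close>,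
  \<open>1 - z / y\<close>, \<open>z / y - z\<close> on \<open>111\<close>, \<open>0v0\<close>, \<open>v00\<close>, and fairness of \<open>A|H\<close> determines the
  weight of \<open>1vv\<close>; that last weight is nonnegative exactly when \<open>1/z \<ge> 1/x + 1/y - 1\<close>, that is, when
  \<open>z\<close> is at most the Hamacher t-norm \<open>T\<close> of \<open>x\<close> and \<open>y\<close> (\<open>le_hamacher0_imp_coherent\<close>).

  Conversely (\<open>coherent_imp_le_hamacher0\<close>), let \<open>0 < x < 1\<close>, \<open>0 < y\<close> and \<open>z > T\<close>.  The stakes
  \<open>-T/x\<close>, \<open>-T/y\<close>, \<open>1\<close> give the same gain \<open>T - z < 0\<close> in each of the cases \<open>111\<close>,
  \<open>0v0\<close>, \<open>v00\<close>, and lose in the other two cases as well.  These stakes break down at the boundary: for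
  \<open>x = 0\<close> or \<open>y = 0\<close> the divisions are meaningless, and for \<open>x = 1\<close> the case \<open>1vv\<close> gains \<open>0\<close>.
  There the bound is \<open>z \<le> 0\<close> or \<open>z \<le> y\<close>, and bets of the conjunction against one of the other two
  conditional events enforce it.
\<close>

section \<open>Coherence as absence of a sure loss\<close>

definition bet :: "'w cond_event list \<Rightarrow> real list \<Rightarrow> nat \<Rightarrow> 'w \<Rightarrow> real" where
  "bet F P j w = indicator (condition (F ! j)) w * (indicator (conclusion (F ! j)) w - P ! j)"

lemma gain_eq_sum_bet: "gain F P J s w = (\<Sum>j\<in>J. s j * bet F P j w)"
  by (simp add: gain_def bet_def mult.assoc)

lemma gain_uminus: "gain F P J (\<lambda>j. - s j) w = - gain F P J s w"
  by (simp add: gain_def sum_negf)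

text \<open>One of the two inequalities suffices, since reversing all stakes exchanges them.\<close>

lemma coherent_iff_no_sure_loss:
  "coherent F P \<longleftrightarrow>
     length P = length F \<and> (\<forall>C\<in>set F. condition C \<noteq> {}) \<and>
     (\<forall>J s. J \<noteq> {} \<and> J \<subseteq> {..<length F} \<longrightarrow>
        (\<exists>w\<in>(\<Union>j\<in>J. condition (F ! j)). 0 \<le> gain F P J s w))"
proof -
  let ?U = "\<lambda>J. \<Union>j\<in>J. condition (F ! j)"
  have *: "Min (gain F P J s ` ?U J) \<le> 0 \<and> 0 \<le> Max (gain F P J s ` ?U J) \<longleftrightarrow>
      (\<exists>w\<in>?U J. 0 \<le> gain F P J (\<lambda>j. - s j) w) \<and> (\<exists>w\<in>?U J. 0 \<le> gain F P J s w)"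
    if ne: "\<forall>C\<in>set F. condition C \<noteq> {}" and J: "J \<noteq> {} \<and> J \<subseteq> {..<length F}" for J s
  proof -
    have "finite (range (gain F P J s))"
      using J finite_range_gain finite_subset by blast
    then have fin: "finite (gain F P J s ` ?U J)"
      by (rule rev_finite_subset) blast
    obtain j where "j \<in> J" "condition (F ! j) \<noteq> {}"
      using ne J nth_mem by (metis ex_in_conv lessThan_iff subsetD)
    then have nonempty: "gain F P J s ` ?U J \<noteq> {}"
      by blast
    show ?thesis
      unfolding Min_le_iff[OF fin nonempty] Max_ge_iff[OF fin nonempty]
      by (simp add: gain_uminus)
  qed
  show ?thesis
    unfolding coherent_def
  proof (intro conj_cong refl iffI allI impI)
    fix J s
    assume ne: "\<forall>C\<in>set F. condition C \<noteq> {}" and J: "J \<noteq> {} \<and> J \<subseteq> {..<length F}"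
      and coh: "\<forall>J s. J \<noteq> {} \<and> J \<subseteq> {..<length F} \<longrightarrow>
        Min (gain F P J s ` ?U J) \<le> 0 \<and> 0 \<le> Max (gain F P J s ` ?U J)"
    show "\<exists>w\<in>?U J. 0 \<le> gain F P J s w"
      using coh[rule_format, OF J, of s] unfolding *[OF ne J, of s] by (rule conjunct2)
  next
    fix J s
    assume ne: "\<forall>C\<in>set F. condition C \<noteq> {}" and J: "J \<noteq> {} \<and> J \<subseteq> {..<length F}"
      and no_loss: "\<forall>J s. J \<noteq> {} \<and> J \<subseteq> {..<length F} \<longrightarrow>
        (\<exists>w\<in>?U J. 0 \<le> gain F P J s w)"
    show "Min (gain F P J s ` ?U J) \<le> 0 \<and> 0 \<le> Max (gain F P J s ` ?U J)"
      unfolding *[OF ne J, of s]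
      using no_loss[rule_format, OF J, of s] no_loss[rule_format, OF J, of "\<lambda>j. - s j"]
      by (rule conjI[rotated])
  qed
qed

lemma sure_loss_imp_not_coherent:
  assumes "J \<noteq> {}" "J \<subseteq> {..<length F}"
    and "\<And>j w. j \<in> J \<Longrightarrow> w \<in> condition (F ! j) \<Longrightarrow> gain F P J s w < 0"
  shows "\<not> coherent F P"
proof
  assume "coherent F P"
  then have "\<exists>w\<in>(\<Union>j\<in>J. condition (F ! j)). 0 \<le> gain F P J s w"
    using assms(1,2) unfolding coherent_iff_no_sure_loss by blast
  with assms(3) show False
    by (meson UN_E not_le)
qed

lemma coherent_bounds:
  assumes "coherent F P" "j < length F"
  shows "P ! j \<in> {0..1}"
proof (rule ccontr)
  assume "P ! j \<notin> {0..1}"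
  then consider "P ! j < 0" | "1 < P ! j" by fastforce
  then have "\<not> coherent F P"
  proof cases
    case 1
    then show ?thesis
      by (intro sure_loss_imp_not_coherent[where J = "{j}" and s = "\<lambda>_. - 1"])
        (use assms(2) in \<open>auto simp: gain_def indicator_def of_bool_def\<close>)
  next
    case 2
    then show ?thesis
      by (intro sure_loss_imp_not_coherent[where J = "{j}" and s = "\<lambda>_. 1"])
        (use assms(2) in \<open>auto simp: gain_def indicator_def of_bool_def\<close>)
  qed
  with assms(1) show False by simp
qed

text \<open>
  The weighted mean of the gain vanishes, so the gain cannot be negative at every weighted case.
  Weights are attached to a list of cases rather than given as a function, so that the sums below
  can be evaluated entry by entry without knowing that the cases are distinct.
\<close>

lemma ex_nonneg_gain_if_fair_weights:
  fixes ws :: "(real \<times> 'w) list"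
  assumes relevant: "\<And>m w. (m, w) \<in> set ws \<Longrightarrow> w \<in> U"
    and nonneg: "\<And>m w. (m, w) \<in> set ws \<Longrightarrow> 0 \<le> m"
    and positive: "0 < (\<Sum>(m, w)\<leftarrow>ws. m)"
    and fair: "\<And>j. j \<in> J \<Longrightarrow> (\<Sum>(m, w)\<leftarrow>ws. m * bet F P j w) = 0"
  shows "\<exists>w\<in>U. 0 \<le> gain F P J s w"
proof (rule ccontr)
  assume "\<not> ?thesis"
  then have loss: "gain F P J s w < 0" if "(m, w) \<in> set ws" for m w
    using relevant that by (meson not_le)
  have "(\<Sum>(m, w)\<leftarrow>ws. m * gain F P J s w) = (\<Sum>j\<in>J. s j * (\<Sum>(m, w)\<leftarrow>ws. m * bet F P j w))"
    by (induction ws)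
      (auto simp: gain_eq_sum_bet sum_distrib_left sum.distrib algebra_simps)
  also have "\<dots> = 0"
    using fair by simp
  finally have mean: "(\<Sum>(m, w)\<leftarrow>ws. m * gain F P J s w) = 0" .
  have "(\<Sum>(m, w)\<leftarrow>ws. m * gain F P J s w) < 0"
    if "0 < (\<Sum>(m, w)\<leftarrow>ws. m)" "\<And>m w. (m, w) \<in> set ws \<Longrightarrow> 0 \<le> m \<and> gain F P J s w < 0"
    for ws
    using that
  proof (induction ws)
    case (Cons p ws)
    obtain m w where p: "p = (m, w)" by fastforce
    have m: "0 \<le> m" "gain F P J s w < 0"
      using Cons.prems(2) p by auto
    have rest: "(\<Sum>(m, w)\<leftarrow>ws. m * gain F P J s w) \<le> 0"
      by (rule sum_list_nonpos) (use Cons.prems(2) in \<open>force intro: mult_nonneg_nonpos\<close>)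
    show ?case
    proof (cases "m = 0")
      case True
      then show ?thesis using Cons p by auto
    next
      case False
      then show ?thesis using m rest p mult_pos_neg[of m "gain F P J s w"] by simp
    qed
  qed simp
  with mean positive nonneg loss show False
    by fastforce
qed

section \<open>The Hamacher t-norm with parameter 0\<close>

lemma hamacher0_denominator_pos:
  fixes x y :: real
  assumes "0 \<le> x" "x \<le> 1" "0 < y"
  shows "0 < x + y - x * y"
proof (cases "x = 0")
  case False
  have "0 \<le> y * (1 - x)" using assms by simp
  moreover have "y * (1 - x) = y - x * y" by (simp add: algebra_simps)
  ultimately show ?thesis using False assms by linarith
qed (use assms in simp)

lemma le_hamacher0_iff:
  assumes "0 \<le> x" "x \<le> 1" "0 < y"
  shows "z \<le> hamacher0 x y \<longleftrightarrow> z * (x + y - x * y) \<le> x * y"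
  using hamacher0_denominator_pos[OF assms] assms
  by (auto simp: hamacher0_def pos_le_divide_eq mult_le_0_iff)

text \<open>This is \<open>1/T = 1/x + 1/y - 1\<close> multiplied by \<open>T\<close>, in the form in which the gain in the case
  \<open>111\<close> uses it.\<close>

lemma hamacher0_equalizes:
  assumes "0 < x" "x \<le> 1" "0 < y"
  shows "1 + hamacher0 x y = hamacher0 x y / x + hamacher0 x y / y"
proof -
  define D where "D = x + y - x * y"
  have "0 < D" unfolding D_def using assms by (intro hamacher0_denominator_pos) auto
  moreover have "hamacher0 x y = x * y / D" using assms by (simp add: hamacher0_def D_def)
  ultimately have "1 + hamacher0 x y = (D + x * y) / D"
    "hamacher0 x y / x + hamacher0 x y / y = (x + y) / D"
    using assms by (simp_all add: add_divide_distrib)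
  then show ?thesis by (simp add: D_def)
qed

lemma hamacher0_le_right:
  assumes "0 \<le> x" "x \<le> 1" "0 \<le> y"
  shows "hamacher0 x y \<le> y"
proof (cases "x = 0 \<or> y = 0")
  case False
  have "0 \<le> y * (y * (1 - x))" using assms by simp
  then have "x * y \<le> y * (x + y - x * y)" by (simp add: algebra_simps)
  then show ?thesis
    using False assms hamacher0_denominator_pos[of x y]
    by (simp add: hamacher0_def pos_divide_le_eq)
qed (use assms in \<open>auto simp: hamacher0_def\<close>)

section \<open>The Farrell conditional and the Kleene conjunction\<close>

context
  fixes A B H K :: "'w set" and x y z :: real and F :: "'w cond_event list" and P :: "real list"
  defines "F \<equiv> [A \<parallel> H, farrell (B \<parallel> K) (A \<parallel> H), conj_K (A \<parallel> H) (B \<parallel> K)]"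
    and "P \<equiv> [x, y, z]"
begin

text \<open>Each violation of the bounds is refuted by explicit stakes that lose surely.\<close>

lemma coherent_imp_le_hamacher0:
  assumes "coherent F P"
  shows "x \<in> {0..1} \<and> y \<in> {0..1} \<and> z \<in> {0..hamacher0 x y}"
proof -
  have x: "0 \<le> x" "x \<le> 1" and y: "0 \<le> y" "y \<le> 1" and z: "0 \<le> z" "z \<le> 1"
    using coherent_bounds[OF assms, of 0] coherent_bounds[OF assms, of 1]
      coherent_bounds[OF assms, of 2] by (auto simp: F_def P_def)
  have zy: "z \<le> y"
  proof (rule ccontr)
    assume "\<not> ?thesis"
    \<comment> \<open>In every relevant case the gain is \<open>y - z\<close> or \<open>- z\<close>.\<close>
    then have "y < z" "0 < z" using y by auto
    then have "\<not> coherent F P"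
      by (intro sure_loss_imp_not_coherent[where J = "{1, 2}" and
            s = "\<lambda>j. if j = 1 then - 1 else 1"])
        (auto simp: F_def P_def gain_def indicator_def of_bool_def)
    with assms show False by simp
  qed
  have "z \<le> hamacher0 x y"
  proof (cases "x = 0 \<or> x = 1 \<or> y = 0")
    case True
    have "z = 0" if "x = 0"
    proof (rule ccontr)
      assume "z \<noteq> 0"
      \<comment> \<open>Now the gain is \<open>- z\<close>, \<open>- 1\<close> or \<open>- 1 - z\<close>.\<close>
      then have "0 < z" using z by simp
      with that have "\<not> coherent F P"
        by (intro sure_loss_imp_not_coherent[where J = "{0, 2}" and
              s = "\<lambda>j. if j = 0 then - 1 else 1"])
          (auto simp: F_def P_def gain_def indicator_def of_bool_def)
      with assms show False by simp
    qed
    then show ?thesis using True zy by (auto simp: hamacher0_def)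
  next
    case False
    then have pos: "0 < x" "x < 1" "0 < y" using x y by auto
    define T where "T = hamacher0 x y"
    have T: "1 + T = T / x + T / y"
      unfolding T_def using pos by (intro hamacher0_equalizes) auto
    have "0 < T"
      using pos hamacher0_denominator_pos[of x y] by (simp add: T_def hamacher0_def)
    then have Tx: "T < T / x" using pos by (simp add: field_simps)
    show ?thesis
    proof (rule ccontr)
      assume "\<not> ?thesis"
      then have "T < z" by (simp add: T_def)
      with T Tx pos have "\<not> coherent F P"
        by (intro sure_loss_imp_not_coherent[where J = "{0, 1, 2}" and
              s = "\<lambda>j. if j = 0 then - T / x else if j = 1 then - T / y else 1"])
          (auto simp: F_def P_def gain_def indicator_def of_bool_def algebra_simps)
      with assms show False by simp
    qed
  qed
  with x y z show ?thesis by simp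
qed

text \<open>
  Every subfamily \<open>J\<close> gets its own fair weights, since its weighted cases must not be void for all
  its members.  If \<open>J\<close> contains \<open>A|H\<close> but not the conjunction, the cases \<open>1vv\<close> and \<open>0v0\<close> suffice,
  whether or not the Farrell conditional belongs to \<open>J\<close>: it is void in both.
  The case \<open>100\<close> never gets any weight.
\<close>

lemma le_hamacher0_imp_coherent:
  assumes indep: "logically_independent A B H K"
    and x: "x \<in> {0..1}" and y: "y \<in> {0..1}" and z: "z \<in> {0..hamacher0 x y}"
  shows "coherent F P"
proof -
  have "A \<inter> B \<inter> H \<inter> K \<noteq> {}" "A \<inter> B \<inter> H \<inter> - K \<noteq> {}"
    "- A \<inter> B \<inter> H \<inter> K \<noteq> {}" "A \<inter> - B \<inter> - H \<inter> K \<noteq> {}"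
    using indep by (simp_all add: logically_independent_def)
  \<comment> \<open>The names spell out the values of the three conditional events.\<close>
  then obtain w111 w1vv w0v0 wv00 where "w111 \<in> A \<inter> B \<inter> H \<inter> K"
    "w1vv \<in> A \<inter> B \<inter> H \<inter> - K" "w0v0 \<in> - A \<inter> B \<inter> H \<inter> K" "wv00 \<in> A \<inter> - B \<inter> - H \<inter> K"
    by (meson ex_in_conv)
  then have w: "w111 \<in> A" "w111 \<in> H" "w111 \<in> B" "w111 \<in> K"
    "w1vv \<in> A" "w1vv \<in> H" "w1vv \<notin> K" "w0v0 \<notin> A" "w0v0 \<in> H"
    "wv00 \<notin> H" "wv00 \<notin> B" "wv00 \<in> K"
    by simp_all
  have zy: "z \<le> y" using hamacher0_le_right[of x y] x y z by auto
  have zxy: "z * (x + y - x * y) \<le> x * y" if "0 < y"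
    using le_hamacher0_iff[of x y z] x z that by auto
  have bets:
    "bet F P 0 w111 = 1 - x" "bet F P 1 w111 = 1 - y" "bet F P 2 w111 = 1 - z"
    "bet F P 0 w1vv = 1 - x" "bet F P 1 w1vv = 0"     "bet F P 2 w1vv = 0"
    "bet F P 0 w0v0 = - x"   "bet F P 1 w0v0 = 0"     "bet F P 2 w0v0 = - z"
    "bet F P 0 wv00 = 0"     "bet F P 1 wv00 = - y"   "bet F P 2 wv00 = - z"
    using w by (simp_all add: bet_def F_def P_def)
  \<comment> \<open>The simplified copy matches terms in which the simplifier has turned the index \<open>1\<close> into
    \<open>Suc 0\<close>.\<close>
  note bets = bets bets[simplified]
  have "\<exists>w\<in>(\<Union>j\<in>J. condition (F ! j)). 0 \<le> gain F P J s w"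
    if J: "J \<noteq> {}" "J \<subseteq> {..<length F}" for J s
  proof -
    have J3: "j = 0 \<or> j = 1 \<or> j = 2" if "j \<in> J" for j
      using that J(2) by (auto simp: F_def less_Suc_eq)
    define U where "U = (\<Union>j\<in>J. condition (F ! j))"
    have in0: "w1vv \<in> U" "w0v0 \<in> U" if "0 \<in> J"
      unfolding U_def using that w by (auto simp: F_def intro!: bexI[of _ 0])
    have in1: "w111 \<in> U" "wv00 \<in> U" if "1 \<in> J"
      unfolding U_def using that w by (auto simp: F_def intro!: bexI[of _ 1])
    have in2: "w111 \<in> U" "w0v0 \<in> U" "wv00 \<in> U" if "2 \<in> J"
      unfolding U_def using that w by (auto simp: F_def intro!: bexI[of _ 2])
    have "J = {1}" if "0 \<notin> J" "2 \<notin> J"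
      using J3 J(1) that by blast
    moreover have "x = 1 \<or> x < 1" "y = 0 \<or> 0 < y"
      using x y by auto
    ultimately consider (only1) "J = {1}" | (no2) "0 \<in> J" "2 \<notin> J" | (y0) "2 \<in> J" "y = 0"
      | (no0) "0 \<notin> J" "2 \<in> J" "0 < y" | (x1) "0 \<in> J" "2 \<in> J" "x = 1"
      | (full) "0 \<in> J" "2 \<in> J" "x < 1" "0 < y"
      by blast
    then have "\<exists>w\<in>U. 0 \<le> gain F P J s w"
    proof cases
      case only1
      then show ?thesis
        by (intro ex_nonneg_gain_if_fair_weights[where ws = "[(y, w111), (1 - y, wv00)]"])
          (use in1 y in \<open>auto simp: bets algebra_simps\<close>)
    next
      case no2
      have fair: "(\<Sum>(m, w)\<leftarrow>[(x, w1vv), (1 - x, w0v0)]. m * bet F P j w) = 0" if "j \<in> J" for j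
      proof -
        have "j = 0 \<or> j = 1" using J3[OF that] that no2(2) by blast
        then show ?thesis by (elim disjE) (simp_all add: bets algebra_simps)
      qed
      show ?thesis
        by (rule ex_nonneg_gain_if_fair_weights[OF _ _ _ fair])
          (use in0[OF no2(1)] x in auto)
    next
      case y0
      then have "z = 0" using z by (simp add: hamacher0_def)
      then have fair: "(\<Sum>(m, w)\<leftarrow>[(1, wv00)]. m * bet F P j w) = 0" if "j \<in> J" for j
        using J3[OF that] y0(2) by (elim disjE) (simp_all add: bets)
      show ?thesis
        by (rule ex_nonneg_gain_if_fair_weights[OF _ _ _ fair]) (use in2[OF y0(1)] in auto)
    next
      \<comment> \<open>The condition of the conjunction has total weight \<open>1\<close>, that of the Farrell conditional
        \<open>z / y\<close>; both contain \<open>w111\<close>, of weight \<open>z\<close>.\<close>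
      case no0
      have zdiv: "z / y \<le> 1" "z \<le> z / y"
        using no0 zy y z by (auto simp: pos_le_divide_eq mult_left_le)
      have fair: "(\<Sum>(m, w)\<leftarrow>[(z, w111), (1 - z / y, w0v0), (z / y - z, wv00)]. m * bet F P j w) = 0"
        if "j \<in> J" for j
      proof -
        have "j = 1 \<or> j = 2" using J3[OF that] that no0(1) by blast
        then show ?thesis using no0(3) by (elim disjE) (simp_all add: bets field_simps)
      qed
      show ?thesis
        by (rule ex_nonneg_gain_if_fair_weights[OF _ _ _ fair])
          (use zdiv in2[OF no0(2)] z in auto)
    next
      \<comment> \<open>The general weights below all vanish when \<open>x = 1\<close> and \<open>z = y\<close>, so this value is separate.\<close>
      case x1
      have fair: "(\<Sum>(m, w)\<leftarrow>[(1, w1vv)]. m * bet F P j w) = 0" if "j \<in> J" for j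
        using J3[OF that] x1(3) by (elim disjE) (simp_all add: bets)
      show ?thesis
        by (rule ex_nonneg_gain_if_fair_weights[OF _ _ _ fair]) (use in0[OF x1(1)] in auto)
    next
      case full
      have zdiv: "z / y \<le> 1" "z \<le> z / y"
        using full zy y z by (auto simp: pos_le_divide_eq mult_left_le)
      \<comment> \<open>The weights of case \<open>no0\<close>, scaled by \<open>1 - x\<close>, together with the weight of
        \<open>w1vv\<close> that makes \<open>A|H\<close> fair; this is where the bound on \<open>z\<close> enters.\<close>
      define ws where "ws = [((1 - x) * z, w111), ((1 - x) * (1 - z / y), w0v0),
        ((1 - x) * (z / y - z), wv00), (x * (1 - z / y) - (1 - x) * z, w1vv)]"
      have nonneg: "0 \<le> x * (1 - z / y) - (1 - x) * z"
        using zxy full by (simp add: field_simps)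
      have fair: "(\<Sum>(m, w)\<leftarrow>ws. m * bet F P j w) = 0" if "j \<in> J" for j
        using J3[OF that] full(4) by (elim disjE) (simp_all add: ws_def bets field_simps)
      have "(\<Sum>(m, w)\<leftarrow>ws. m) = (1 - x) + (x * (1 - z / y) - (1 - x) * z)"
        by (simp add: ws_def algebra_simps)
      with nonneg full(3) have positive: "0 < (\<Sum>(m, w)\<leftarrow>ws. m)"
        by linarith
      show ?thesis
        by (rule ex_nonneg_gain_if_fair_weights[OF _ _ positive fair])
          (use nonneg zdiv full(3) z in0[OF full(1)] in2[OF full(2)] in \<open>auto simp: ws_def\<close>)
    qed
    then show ?thesis by (simp only: U_def)
  qed
  moreover have "\<forall>C\<in>set F. condition C \<noteq> {}"
    using w by (auto simp: F_def)
  ultimately show ?thesis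
    by (simp add: coherent_iff_no_sure_loss F_def P_def)
qed

end

theorem theorem8:
  fixes A B H K :: "'w set" and x y z :: real
  assumes "logically_independent A B H K"
  shows "coherent [A \<parallel> H, farrell (B \<parallel> K) (A \<parallel> H), conj_K (A \<parallel> H) (B \<parallel> K)] [x, y, z]
    \<longleftrightarrow> (x, y) \<in> {0..1} \<times> {0..1} \<and> z \<in> {0..hamacher0 x y}"
proof
  assume "coherent [A \<parallel> H, farrell (B \<parallel> K) (A \<parallel> H), conj_K (A \<parallel> H) (B \<parallel> K)] [x, y, z]"
  from coherent_imp_le_hamacher0[OF this]
  show "(x, y) \<in> {0..1} \<times> {0..1} \<and> z \<in> {0..hamacher0 x y}"
    by blast
next
  assume "(x, y) \<in> {0..1} \<times> {0..1} \<and> z \<in> {0..hamacher0 x y}"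
  then show "coherent [A \<parallel> H, farrell (B \<parallel> K) (A \<parallel> H), conj_K (A \<parallel> H) (B \<parallel> K)] [x, y, z]"
    by (intro le_hamacher0_imp_coherent[OF assms]) blast+
qed

end
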